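(* Let $\Omega=[0,1]^n$, let $f:\Omega\to\mathbb{R}$ be continuously differentiable with each partial derivative $\partial_i f$ being $L_i$-Lipschitz continuous on $\Omega$ ($i=1,\dots,n$), and let $\sigma\in\mathbb{R}^n$ satisfy $\sigma_i>0$ for all $i$. Let $S:\mathbb{R}^n\to(0,1)^n$ be the sigmoidal warping with parameter $\sigma$ and let $\tilde f_\sigma=f\circ S$. A point $y^*$ in the interior $(0,1)^n$ of $\Omega$ is a stationary point of $f$ (i.e. $\nabla f(y^* )=0$) if and only if $x^*=S^{-1}(y^* )$ is a stationary point of $\tilde f_\sigma$ (i.e. $\nabla\tilde f_\sigma(x^* )=0$).
   Context: For $\sigma\in\mathbb{R}^n$ with all entries strictly positive, the sigmoidal warping $S:\mathbb{R}^n\to(0,1)^n$ is defined componentwise by $S(x)_i=\frac{1}{1+e^{-\sigma_i x_i}}$; it is a bijection onto $(0,1)^n$. The merit function is $\tilde f_\sigma:\mathbb{R}^n\to\mathbb{R}$, $\tilde f_\sigma(x)=f(S(x))$. *)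

theory Defs
  imports "HOL-Analysis.Analysis"
begin

(* On the closed unit cube the derivative within the cube is unique at every point, boundary
   points included (frechet_derivative_unique_within_closed_interval), so for f differentiable
   on the cube the value below does not depend on the choice made in frechet_derivative. On faces
   it is the one-sided partial derivative. *)
definition partial_deriv_within ::
    "(real ^ 'n) set \<Rightarrow> 'n \<Rightarrow> (real ^ 'n \<Rightarrow> real) \<Rightarrow> real ^ 'n \<Rightarrow> real" where
  "partial_deriv_within A i f x = frechet_derivative f (at x within A) (axis i 1)"

definition continuously_differentiable_on ::
    "(real ^ 'n \<Rightarrow> real) \<Rightarrow> (real ^ 'n) set \<Rightarrow> bool" where
  "continuously_differentiable_on f A \<longleftrightarrow>
     f differentiable_on A \<and> (\<forall>i. continuous_on A (partial_deriv_within A i f))"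

(* Gradient zero as a relation: it includes differentiability at x. At an interior point of a set,
   it depends only on the values of f on that set. *)
definition stationary_point :: "(real ^ 'n \<Rightarrow> real) \<Rightarrow> real ^ 'n \<Rightarrow> bool" where
  "stationary_point f x \<longleftrightarrow> GDERIV f x :> 0"

definition sigmoidal_warping :: "real ^ 'n \<Rightarrow> real ^ 'n \<Rightarrow> real ^ 'n" where
  "sigmoidal_warping \<sigma> x = (\<chi> i. 1 / (1 + exp (- (\<sigma> $ i) * x $ i)))"

definition merit_function :: "real ^ 'n \<Rightarrow> (real ^ 'n \<Rightarrow> real) \<Rightarrow> real ^ 'n \<Rightarrow> real" where
  "merit_function \<sigma> f = f \<circ> sigmoidal_warping \<sigma>"

end

theory Submission
  imports Defs
begin

text \<open>The derivative of the warping at any point is a diagonal map with positive entries, hence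
  surjective. By the chain rule the derivative of \<open>f \<circ> S\<close> at \<open>x\<close> is the derivative of \<open>f\<close> at
  \<open>S x\<close> composed with this surjection, so one vanishes iff the other does.\<close>

text \<open>This makes \<open>inv (sigmoidal_warping \<sigma>) y\<close> a genuine preimage of a
  point \<open>y\<close> of the open cube; off the range, \<open>inv\<close> gives an arbitrary
  value.\<close>

lemma box_subset_range_sigmoidal_warping:
  fixes \<sigma> :: "real ^ 'n"
  assumes "\<And>i. 0 < \<sigma> $ i"
  shows "box 0 1 \<subseteq> range (sigmoidal_warping \<sigma>)"
proof
  fix y :: "real ^ 'n" assume "y \<in> box 0 1"
  then have y: "0 < y $ i" "y $ i < 1" for i by (auto simp: mem_box_cart)
  \<comment> \<open>Solving the logistic equation for the coordinate gives the logit of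
    \<open>y $ i\<close>, divided by \<open>\<sigma> $ i\<close>.\<close>
  have "1 / (1 + exp (- (\<sigma> $ i) * (ln (y $ i / (1 - y $ i)) / \<sigma> $ i))) = y $ i" for i
    using y[of i] assms[of i] by (simp add: exp_minus field_simps)
  then have "sigmoidal_warping \<sigma> (\<chi> i. ln (y $ i / (1 - y $ i)) / \<sigma> $ i) = y"
    unfolding sigmoidal_warping_def by (simp add: vec_eq_iff)
  then show "y \<in> range (sigmoidal_warping \<sigma>)" by (metis rangeI)
qed

text \<open>Each component is a logistic function of its own coordinate alone, so the one-variable
  derivative and the chain rule along the projection to that coordinate give a diagonal map.\<close>

lemma has_derivative_sigmoidal_warping:
  "(sigmoidal_warping \<sigma> has_derivative
     (\<lambda>h. \<chi> i. \<sigma> $ i * exp (- (\<sigma> $ i) * x $ i) / (1 + exp (- (\<sigma> $ i) * x $ i))\<^sup>2 * h $ i)) (at x)"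
proof -
  have "((\<lambda>x. 1 / (1 + exp (- (\<sigma> $ i) * x $ i))) has_derivative
     (\<lambda>h. \<sigma> $ i * exp (- (\<sigma> $ i) * x $ i) / (1 + exp (- (\<sigma> $ i) * x $ i))\<^sup>2 * h $ i)) (at x)" for i
  proof -
    have "1 + exp (- (\<sigma> $ i) * t) \<noteq> 0" for t
      by (smt (verit) exp_gt_zero)
    then have "((\<lambda>t. 1 / (1 + exp (- (\<sigma> $ i) * t))) has_real_derivative
        \<sigma> $ i * exp (- (\<sigma> $ i) * t) / (1 + exp (- (\<sigma> $ i) * t))\<^sup>2) (at t)" for t
      by (auto intro!: derivative_eq_intros simp: power2_eq_square)
    moreover have "((\<lambda>x. x $ i) has_derivative (\<lambda>h. h $ i)) (at x)"
      by (intro bounded_linear_imp_has_derivative bounded_linear_vec_nth)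
    ultimately show ?thesis
      using diff_chain_at[of "\<lambda>x. x $ i" _ x] by (fastforce simp: has_field_derivative_def comp_def)
  qed
  then show ?thesis
    by (subst has_derivative_componentwise_within)
      (auto simp: Basis_vec_def inner_axis sigmoidal_warping_def)
qed

lemma surj_derivative_sigmoidal_warping:
  assumes "\<And>i. 0 < \<sigma> $ i" and "(sigmoidal_warping \<sigma> has_derivative S') (at x)"
  shows "surj S'"
proof -
  define d where "d i = \<sigma> $ i * exp (- (\<sigma> $ i) * x $ i) / (1 + exp (- (\<sigma> $ i) * x $ i))\<^sup>2" for i
  have "1 + exp (- (\<sigma> $ i) * x $ i) > 0" for i
    by (intro add_pos_pos) auto
  then have d: "d i > 0" for i
    unfolding d_def using assms(1) by (intro divide_pos_pos mult_pos_pos zero_less_power) auto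
  \<comment> \<open>Derivatives at a point are unique, so \<open>S'\<close> must be the explicit
    diagonal map.\<close>
  have "S' = (\<lambda>h. \<chi> i. d i * h $ i)"
    using has_derivative_unique[OF assms(2) has_derivative_sigmoidal_warping] by (simp add: d_def)
  \<comment> \<open>Dividing by the positive diagonal entries gives a right inverse.\<close>
  moreover have "(\<chi> i. d i * (\<chi> i. k $ i / d i) $ i) = k" for k
    using d by (simp add: vec_eq_iff less_imp_neq[symmetric])
  ultimately show ?thesis by (intro surjI[of _ "\<lambda>k. \<chi> i. k $ i / d i"]) simp
qed

text \<open>A zero gradient means that the inner product with 0, which is the zero map, is a
  derivative of \<open>F\<close>; by uniqueness it is then \<open>F'\<close>.\<close>

lemma stationary_point_iff_has_derivative:
  assumes F': "(F has_derivative F') (at z)"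
  shows "stationary_point F z \<longleftrightarrow> F' = (\<lambda>h. 0)"
proof
  assume "stationary_point F z"
  then have "(F has_derivative (\<lambda>h. 0)) (at z)"
    by (simp add: stationary_point_def gderiv_def)
  then show "F' = (\<lambda>h. 0)" by (rule has_derivative_unique[OF F'])
next
  assume "F' = (\<lambda>h. 0)"
  with F' show "stationary_point F z"
    by (simp add: stationary_point_def gderiv_def)
qed

text \<open>If \<open>f' \<circ> g'\<close> vanishes, then \<open>f'\<close> is zero on the range of
  \<open>g'\<close>, which surjectivity makes the whole space.\<close>

lemma stationary_point_comp_iff:
  assumes g: "(g has_derivative g') (at x)" and "surj g'" and f: "f differentiable at (g x)"
  shows "stationary_point (f \<circ> g) x \<longleftrightarrow> stationary_point f (g x)"
proof -
  obtain f' where f': "(f has_derivative f') (at (g x))"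
    using f by (auto simp: differentiable_def)
  note iffs = stationary_point_iff_has_derivative[OF f']
    stationary_point_iff_has_derivative[OF diff_chain_at[OF g f']]
  have "f' \<circ> g' = (\<lambda>h. 0) \<longleftrightarrow> f' = (\<lambda>h. 0)"
  proof
    assume eq: "f' \<circ> g' = (\<lambda>h. 0)"
    show "f' = (\<lambda>h. 0)"
    proof
      fix k
      obtain h where "k = g' h" using surjD[OF \<open>surj g'\<close>] by blast
      then show "f' k = 0" using fun_cong[OF eq, of h] by simp
    qed
  qed (simp add: comp_def)
  then show ?thesis by (simp only: iffs)
qed

theorem theorem1:
  fixes f :: "real ^ 'n \<Rightarrow> real" and \<sigma> :: "real ^ 'n" and L :: "'n \<Rightarrow> real" and y :: "real ^ 'n"
  assumes "continuously_differentiable_on f (cbox 0 1)"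
    and "\<And>i. (L i)-lipschitz_on (cbox 0 1) (partial_deriv_within (cbox 0 1) i f)"
    and "\<And>i. 0 < \<sigma> $ i"
    and "y \<in> box 0 1"
  shows "stationary_point f y \<longleftrightarrow>
    stationary_point (merit_function \<sigma> f) (inv (sigmoidal_warping \<sigma>) y)"
proof -
  let ?S = "sigmoidal_warping \<sigma>"
  define x where "x = inv ?S y"
  have Sx: "?S x = y"
    unfolding x_def using box_subset_range_sigmoidal_warping[OF assms(3)] assms(4)
    by (intro f_inv_into_f) auto
  have "f differentiable at y within cbox 0 1"
    using assms(1,4) box_subset_cbox
    by (auto simp: continuously_differentiable_on_def differentiable_on_def)
  \<comment> \<open>\<open>y\<close> is interior to the cube, so differentiability within the cube
    is full differentiability there.\<close>
  then have "f differentiable at (?S x)"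
    using at_within_interior[of y "cbox 0 1"] assms(4) Sx by simp
  moreover note S' = has_derivative_sigmoidal_warping[of \<sigma> x]
  ultimately have "stationary_point (f \<circ> ?S) x \<longleftrightarrow> stationary_point f (?S x)"
    using surj_derivative_sigmoidal_warping[OF assms(3) S'] by (intro stationary_point_comp_iff)
  then show ?thesis
    by (simp add: Sx merit_function_def flip: x_def)
qed

end
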